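(* Let $(u_h,\boldsymbol q_h)\in\mathcal V_h^{p-1}\times\boldsymbol{\mathcal H}_h^p$ be the solution of the discrete mixed problem (MFEM). Let $\widetilde u_h\in\mathcal V_h^{p+1}$ be the function satisfying, for each $K\in\mathcal T_h$, $$(\nabla\widetilde u_h,\nabla v_K)_K=-(\boldsymbol q_h,\nabla v_K)_K\quad\forall v_K\in\mathcal V_{*,K}^{p+1},\qquad (\widetilde u_h,1)_K=(u_h,1)_K .$$ Let $\nu_h\in\mathcal V_h^{p+1}$ be the solution of the local residual minimization problems: for each $K\in\mathcal T_h$, $$\nu_h|_K=\operatorname*{arg\,min}_{w_K\in\mathcal V_K^{p+1}}\tfrac12\|\boldsymbol q_h+\nabla w_K\|_{*,K}^2,\qquad (\nu_h,1)_K=(u_h,1)_K$$ (that is, $\nu_h|_K$ is the minimizer whose mean value is fixed by the second condition). Then $\nu_h=\widetilde u_h$.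
   Context: Let $\Omega\subset\mathbb R^d$ ($d=2,3$) be a polyhedral Lipschitz domain, and $\{\mathcal T_h\}_{h>0}$ a family of conforming, shape-regular simplicial meshes of $\Omega$. For $D\subset\overline\Omega$, $(\cdot,\cdot)_D$ and $\|\cdot\|_D$ are the $L^2(D)$ inner product and norm (scalar or vector-valued functions); $(\cdot,\cdot)_{\mathcal T_h}=\sum_{K\in\mathcal T_h}(\cdot,\cdot)_K$. Fix an integer $p\ge1$. For an integer $r\ge0$ and $K\in\mathcal T_h$: $\mathcal V_K^r$ is the space of polynomials on $K$ of total degree $\le r$; $\mathcal V_{*,K}^r=\{v\in\mathcal V_K^r:(v,1)_K=0\}$; $\mathcal V_h^r=\{v\in L^2(\Omega):v|_K\in\mathcal V_K^r\ \forall K\in\mathcal T_h\}$; $\boldsymbol{\mathcal H}_h^r=\{\boldsymbol v\in H(\operatorname{div},\Omega):\boldsymbol v|_K\in(\mathcal V_K^r)^d\ \forall K\in\mathcal T_h\}$. Discrete dual norm: $\displaystyle\|\boldsymbol p\|_{*,K}=\sup_{0\ne v_K\in\mathcal V_{*,K}^{p+2}}\frac{(\boldsymbol p,\nabla v_K)_K}{\|\nabla v_K\|_K}$. (MFEM) Given $f\in L^2(\Omega)$ and $u_D\in H^{1/2}(\partial\Omega)$, find $(u_h,\boldsymbol q_h)\in\mathcal V_h^{p-1}\times\boldsymbol{\mathcal H}_h^p$ such that $(\boldsymbol q_h,\boldsymbol p_h)_{\mathcal T_h}-(\operatorname{div}\boldsymbol p_h,u_h)_{\mathcal T_h}=-\langle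 u_D,\boldsymbol p_h\cdot\boldsymbol n\rangle_{\partial\Omega}$ for all $\boldsymbol p_h\in\boldsymbol{\mathcal H}_h^p$, and $(\operatorname{div}\boldsymbol q_h,v_h)_{\mathcal T_h}=(f,v_h)_{\mathcal T_h}$ for all $v_h\in\mathcal V_h^{p-1}$. This problem is well-posed. *)

theory Defs
  imports "HOL-Analysis.Analysis"
begin

section \<open>Square-integrable functions and gradients\<close>

definition square_integrable :: "'a measure \<Rightarrow> ('a \<Rightarrow> 'b::euclidean_space) set" where
  "square_integrable M = {f \<in> borel_measurable M. integrable M (\<lambda>x. f x \<bullet> f x)}"

definition l2_inner ::
    "'a::euclidean_space set \<Rightarrow> ('a \<Rightarrow> 'b::euclidean_space) \<Rightarrow> ('a \<Rightarrow> 'b) \<Rightarrow> real" where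
  "l2_inner D f g = (LINT x|lebesgue_on D. f x \<bullet> g x)"

definition l2_norm :: "'a::euclidean_space set \<Rightarrow> ('a \<Rightarrow> 'b::euclidean_space) \<Rightarrow> real" where
  "l2_norm D f = sqrt (l2_inner D f f)"

text \<open>The classical gradient; unspecified at points where \<open>f\<close> is not differentiable.\<close>

definition grad :: "('a::euclidean_space \<Rightarrow> real) \<Rightarrow> 'a \<Rightarrow> 'a" where
  "grad f x = (THE D. GDERIV f x :> D)"

section \<open>The space H(div)\<close>

primrec continuously_differentiable :: "nat \<Rightarrow> (real ^ 'd \<Rightarrow> real) \<Rightarrow> bool" where
  "continuously_differentiable 0 f \<longleftrightarrow> continuous_on UNIV f"
| "continuously_differentiable (Suc k) f \<longleftrightarrow>
     (\<forall>x. f differentiable (at x)) \<and>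
     (\<forall>i. continuously_differentiable k (\<lambda>x. grad f x $ i))"

definition test_functions :: "(real ^ 'd) set \<Rightarrow> (real ^ 'd \<Rightarrow> real) set" where
  "test_functions \<Omega> = {\<phi>. (\<forall>k. continuously_differentiable k \<phi>) \<and>
     compact (closure {x. \<phi> x \<noteq> 0}) \<and> closure {x. \<phi> x \<noteq> 0} \<subseteq> \<Omega>}"

definition has_weak_div ::
    "(real ^ 'd) set \<Rightarrow> (real ^ 'd \<Rightarrow> real ^ 'd) \<Rightarrow> (real ^ 'd \<Rightarrow> real) \<Rightarrow> bool" where
  "has_weak_div \<Omega> v w \<longleftrightarrow> w \<in> square_integrable (lebesgue_on \<Omega>) \<and>
     (\<forall>\<phi>\<in>test_functions \<Omega>. l2_inner \<Omega> v (grad \<phi>) = - l2_inner \<Omega> w \<phi>)"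

definition H_div :: "(real ^ 'd) set \<Rightarrow> (real ^ 'd \<Rightarrow> real ^ 'd) set" where
  "H_div \<Omega> = {v \<in> square_integrable (lebesgue_on \<Omega>). \<exists>w. has_weak_div \<Omega> v w}"

text \<open>The weak divergence is unique up to null sets, so the choice is irrelevant in integrals.\<close>

definition weak_div :: "(real ^ 'd) set \<Rightarrow> (real ^ 'd \<Rightarrow> real ^ 'd) \<Rightarrow> real ^ 'd \<Rightarrow> real" where
  "weak_div \<Omega> v = (SOME w. has_weak_div \<Omega> v w)"

section \<open>Domains and meshes\<close>

text \<open>Near each boundary point \<open>\<Omega>\<close> is the strict epigraph, in some direction \<open>e\<close>, of a Lipschitz
  function \<open>g\<close> on the hyperplane orthogonal to \<open>e\<close>.\<close>

definition lipschitz_domain :: "'a::euclidean_space set \<Rightarrow> bool" where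
  "lipschitz_domain \<Omega> \<longleftrightarrow> open \<Omega> \<and> connected \<Omega> \<and> bounded \<Omega> \<and> \<Omega> \<noteq> {} \<and>
     (\<forall>x\<in>frontier \<Omega>. \<exists>U e L g. open U \<and> x \<in> U \<and> norm e = 1 \<and>
        L-lipschitz_on {z. z \<bullet> e = 0} g \<and>
        \<Omega> \<inter> U = {y \<in> U. g (y - (y \<bullet> e) *\<^sub>R e) < y \<bullet> e})"

definition polyhedral_lipschitz_domain :: "'a::euclidean_space set \<Rightarrow> bool" where
  "polyhedral_lipschitz_domain \<Omega> \<longleftrightarrow> lipschitz_domain \<Omega> \<and>
     (\<exists>\<P>. finite \<P> \<and> (\<forall>P\<in>\<P>. polytope P) \<and> closure \<Omega> = \<Union>\<P>)"

text \<open>Elements are closed simplices of full dimension. Conformity, i.e. that any two of them meet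
  in a (possibly empty) common face, is part of \<^const>\<open>triangulation\<close>.\<close>

definition conforming_simplicial_mesh :: "(real ^ 'd) set \<Rightarrow> (real ^ 'd) set set \<Rightarrow> bool" where
  "conforming_simplicial_mesh \<Omega> \<T> \<longleftrightarrow>
     triangulation \<T> \<and> (\<forall>K\<in>\<T>. int CARD('d) simplex K) \<and> \<Union>\<T> = closure \<Omega>"

definition inradius :: "'a::euclidean_space set \<Rightarrow> real" where
  "inradius K = Sup {\<rho>. 0 \<le> \<rho> \<and> (\<exists>x. cball x \<rho> \<subseteq> K)}"

definition shape_regular :: "(real \<Rightarrow> 'a::euclidean_space set set) \<Rightarrow> bool" where
  "shape_regular \<T> \<longleftrightarrow> (\<exists>\<sigma>. \<forall>h>0. \<forall>K\<in>\<T> h. diameter K \<le> \<sigma> * inradius K)"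

section \<open>Boundary integrals\<close>

definition hausdorff_outer :: "nat \<Rightarrow> 'a::euclidean_space set \<Rightarrow> ennreal" where
  "hausdorff_outer s A = (SUP \<delta>\<in>{0<..}.
     INF C\<in>{C :: nat \<Rightarrow> 'a set. A \<subseteq> (\<Union>i. C i) \<and> (\<forall>i. bounded (C i) \<and> diameter (C i) \<le> \<delta>)}.
       (\<Sum>i. ennreal (unit_ball_vol (real s) * (diameter (C i) / 2) ^ s)))"

text \<open>The \<open>(d - 1)\<close>-dimensional Hausdorff measure on the boundary, completed so that values on null
  sets (such as the lower-dimensional faces of the boundary) never matter.\<close>

definition surface_measure :: "(real ^ 'd) set \<Rightarrow> (real ^ 'd) measure" where
  "surface_measure \<Omega> = completion (restrict_space
     (measure_of UNIV (sets borel) (hausdorff_outer (CARD('d) - 1))) (frontier \<Omega>))"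

text \<open>The outward unit normal at the points of the boundary where it is flat, which for a polyhedral
  Lipschitz domain are almost all of them.\<close>

definition outward_normal :: "'a::euclidean_space set \<Rightarrow> 'a \<Rightarrow> 'a" where
  "outward_normal \<Omega> x = (THE n. norm n = 1 \<and>
     (\<exists>\<epsilon>>0. \<forall>y\<in>ball x \<epsilon>. y \<in> \<Omega> \<longleftrightarrow> (y - x) \<bullet> n < 0))"

text \<open>\<open>H\<^sup>s(\<partial>\<Omega>)\<close> for \<open>s = 1/2\<close> with the Sobolev-Slobodeckij seminorm; the exponent of the distance is
  \<open>(d - 1) + 2 s = d\<close>.\<close>

definition H_half :: "(real ^ 'd) set \<Rightarrow> (real ^ 'd \<Rightarrow> real) set" where
  "H_half \<Omega> = {u \<in> square_integrable (surface_measure \<Omega>).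
     (\<integral>\<^sup>+x. (\<integral>\<^sup>+y. ennreal ((u x - u y)\<^sup>2 / dist x y ^ CARD('d)) \<partial>surface_measure \<Omega>)
        \<partial>surface_measure \<Omega>) < \<infinity>}"

text \<open>The pairing of \<open>u\<close> with the normal trace of \<open>p\<close>. It is only applied to \<open>u \<in> H_half \<Omega>\<close> and to
  piecewise polynomial \<open>p\<close>, for which the normal trace is square-integrable and the duality pairing
  is this integral; the limit is the trace of \<open>p\<close> from the inside, which exists almost everywhere.\<close>

definition boundary_pairing ::
    "(real ^ 'd) set \<Rightarrow> (real ^ 'd \<Rightarrow> real) \<Rightarrow> (real ^ 'd \<Rightarrow> real ^ 'd) \<Rightarrow> real" where
  "boundary_pairing \<Omega> u p =
     (LINT x|surface_measure \<Omega>. u x * (Lim (at x within \<Omega>) p \<bullet> outward_normal \<Omega> x))"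

section \<open>Polynomial spaces\<close>

text \<open>Polynomials of total degree at most \<open>r\<close>. As elements have nonempty interior, a polynomial on an
  element is identified with the polynomial function on the whole space that extends it.\<close>

definition poly_space :: "nat \<Rightarrow> (real ^ 'd \<Rightarrow> real) set" where
  "poly_space r =
     {v. \<exists>c. v = (\<lambda>x. \<Sum>a | sum a UNIV \<le> r. c a * (\<Prod>i\<in>UNIV. (x $ i) ^ a i))}"

definition poly_space_mean_zero :: "nat \<Rightarrow> (real ^ 'd) set \<Rightarrow> (real ^ 'd \<Rightarrow> real) set" where
  "poly_space_mean_zero r K = {v \<in> poly_space r. l2_inner K v (\<lambda>_. 1) = 0}"

text \<open>The broken spaces consist of functions rather than classes modulo null sets: a class is
  represented by functions that are polynomial on the interior of each element, with arbitrary
  values on the mesh skeleton.\<close>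

definition broken_poly_space ::
    "(real ^ 'd) set \<Rightarrow> (real ^ 'd) set set \<Rightarrow> nat \<Rightarrow> (real ^ 'd \<Rightarrow> real) set" where
  "broken_poly_space \<Omega> \<T> r = {v \<in> square_integrable (lebesgue_on \<Omega>).
     \<forall>K\<in>\<T>. \<exists>P\<in>poly_space r. \<forall>x\<in>interior K. v x = P x}"

definition H_div_poly_space ::
    "(real ^ 'd) set \<Rightarrow> (real ^ 'd) set set \<Rightarrow> nat \<Rightarrow> (real ^ 'd \<Rightarrow> real ^ 'd) set" where
  "H_div_poly_space \<Omega> \<T> r = {v \<in> H_div \<Omega>.
     \<forall>K\<in>\<T>. \<forall>i. \<exists>P\<in>poly_space r. \<forall>x\<in>interior K. v x $ i = P x}"

definition dual_norm :: "nat \<Rightarrow> (real ^ 'd) set \<Rightarrow> (real ^ 'd \<Rightarrow> real ^ 'd) \<Rightarrow> real" where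
  "dual_norm p K \<tau> = (SUP v\<in>{v \<in> poly_space_mean_zero (p + 2) K. v \<noteq> (\<lambda>_. 0)}.
     l2_inner K \<tau> (grad v) / l2_norm K (grad v))"

section \<open>The discrete mixed problem\<close>

definition mfem_solution ::
    "(real ^ 'd) set \<Rightarrow> (real ^ 'd) set set \<Rightarrow> nat \<Rightarrow> (real ^ 'd \<Rightarrow> real) \<Rightarrow> (real ^ 'd \<Rightarrow> real) \<Rightarrow>
     (real ^ 'd \<Rightarrow> real) \<Rightarrow> (real ^ 'd \<Rightarrow> real ^ 'd) \<Rightarrow> bool" where
  "mfem_solution \<Omega> \<T> p f u\<^sub>D u q \<longleftrightarrow>
     u \<in> broken_poly_space \<Omega> \<T> (p - 1) \<and> q \<in> H_div_poly_space \<Omega> \<T> p \<and>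
     (\<forall>r\<in>H_div_poly_space \<Omega> \<T> p.
        (\<Sum>K\<in>\<T>. l2_inner K q r) - (\<Sum>K\<in>\<T>. l2_inner K (weak_div \<Omega> r) u) =
          - boundary_pairing \<Omega> u\<^sub>D r) \<and>
     (\<forall>v\<in>broken_poly_space \<Omega> \<T> (p - 1).
        (\<Sum>K\<in>\<T>. l2_inner K (weak_div \<Omega> q) v) = (\<Sum>K\<in>\<T>. l2_inner K f v))"

end

theory Submission
  imports Defs
begin

text \<open>Fix an element \<open>K\<close>, let \<open>P\<close> and \<open>w\<close> be the polynomials that represent the postprocessed
  solution and the minimizer, and put \<open>g = w - P\<close>. The residual \<open>\<tau> = q + \<nabla>P\<close> is orthogonal to
  gradients of degree \<open>p + 1\<close>, in particular to \<open>\<nabla>g\<close>. Since \<open>g\<close> is itself admissible in the dual norm,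
  Pythagoras' theorem gives \<open>\<parallel>\<tau> + \<nabla>g\<parallel>\<^sub>*\<^sup>2 \<ge> \<parallel>\<tau>\<parallel>\<^sub>*\<^sup>2 + \<parallel>\<nabla>g\<parallel>\<^sup>2\<close>. Minimality of \<open>w\<close> therefore forces
  \<open>\<nabla>g = 0\<close>, and the mean value condition then gives \<open>g = 0\<close>.\<close>

section \<open>Polynomials and their gradients\<close>

lemma GDERIV_unique:
  assumes "GDERIV f x :> D" "GDERIV f x :> E"
  shows "D = E"
proof -
  have "(\<lambda>h. h \<bullet> D) = (\<lambda>h. h \<bullet> E)"
    using assms unfolding gderiv_def by (rule has_derivative_unique)
  then show ?thesis
    by (metis inner_commute vector_eq_rdot)
qed

lemma grad_eqI: "GDERIV f x :> D \<Longrightarrow> grad f x = D"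
  unfolding grad_def using GDERIV_unique by blast

text \<open>The gradient at a point depends only on values nearby. Both definite descriptions range
  over the same predicate, so equality holds even where neither function is differentiable. This
  passes from a broken function to its polynomial on an element.\<close>

lemma grad_cong_open:
  assumes "open S" "x \<in> S" and eq: "\<And>y. y \<in> S \<Longrightarrow> f y = g y"
  shows "grad f x = grad g x"
proof -
  have "GDERIV f x :> D \<longleftrightarrow> GDERIV g x :> D" for D
    unfolding gderiv_def
    using has_derivative_transform_within_open[OF _ assms(1,2)] eq by metis
  then show ?thesis
    by (simp add: grad_def)
qed

text \<open>Stated through \<open>grad\<close> itself, so that \<open>grad f\<close> is a genuine
  gradient at every point; its continuity makes the integrals over compact elements finite.\<close>

definition C1_function :: "('a::euclidean_space \<Rightarrow> real) \<Rightarrow> bool" where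
  "C1_function f \<longleftrightarrow> (\<forall>x. GDERIV f x :> grad f x) \<and> continuous_on UNIV (grad f)"

lemma C1_functionI:
  assumes D: "\<And>x. GDERIV f x :> D x" and "continuous_on UNIV D"
  shows "C1_function f"
proof -
  have "grad f = D"
    using grad_eqI[OF D] by blast
  then show ?thesis
    using assms by (simp add: C1_function_def)
qed

lemma C1_function_GDERIV: "C1_function f \<Longrightarrow> GDERIV f x :> grad f x"
  by (simp add: C1_function_def)

lemma C1_function_continuous: "C1_function f \<Longrightarrow> continuous_on S f"
  unfolding C1_function_def gderiv_def
  by (meson continuous_at_imp_continuous_on has_derivative_continuous)

lemma C1_function_continuous_grad: "C1_function f \<Longrightarrow> continuous_on S (grad f)"
  unfolding C1_function_def by (meson continuous_on_subset subset_UNIV)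

lemma C1_function_const: "C1_function (\<lambda>_. c)"
  by (rule C1_functionI[OF GDERIV_const]) auto

lemma C1_function_add:
  assumes "C1_function f" "C1_function g"
  shows "C1_function (\<lambda>x. f x + g x)"
  by (rule C1_functionI[OF GDERIV_add[OF assms[THEN C1_function_GDERIV]]])
     (intro continuous_intros assms[THEN C1_function_continuous_grad])

lemma C1_function_mult:
  assumes "C1_function f" "C1_function g"
  shows "C1_function (\<lambda>x. f x * g x)"
  by (rule C1_functionI[OF GDERIV_mult[OF assms[THEN C1_function_GDERIV]]])
     (intro continuous_intros assms[THEN C1_function_continuous_grad]
       assms[THEN C1_function_continuous])

lemma C1_function_component: "C1_function (\<lambda>x :: real ^ 'd. x $ i)"
proof (rule C1_functionI)
  show "GDERIV (\<lambda>x :: real ^ 'd. x $ i) x :> axis i 1" for x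
    unfolding gderiv_def inner_axis
    using bounded_linear_imp_has_derivative[OF bounded_linear_vec_nth] by simp
qed auto

lemma C1_function_sum: "(\<And>i. i \<in> I \<Longrightarrow> C1_function (f i)) \<Longrightarrow> C1_function (\<lambda>x. \<Sum>i\<in>I. f i x)"
  by (induction I rule: infinite_finite_induct) (auto intro: C1_function_const C1_function_add)

lemma C1_function_prod: "(\<And>i. i \<in> I \<Longrightarrow> C1_function (f i)) \<Longrightarrow> C1_function (\<lambda>x. \<Prod>i\<in>I. f i x)"
  by (induction I rule: infinite_finite_induct) (auto intro: C1_function_const C1_function_mult)

lemma C1_function_power: "C1_function f \<Longrightarrow> C1_function (\<lambda>x. f x ^ n)"
  by (induction n) (auto intro: C1_function_const C1_function_mult)

lemma poly_space_C1:
  assumes "v \<in> poly_space r"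
  shows "C1_function v"
  using assms unfolding poly_space_def
  by (auto intro!: C1_function_sum C1_function_prod C1_function_mult C1_function_const
      C1_function_power C1_function_component)

lemma grad_linear_combination:
  assumes "C1_function f" "C1_function g"
  shows "grad (\<lambda>x. a * f x + b * g x) = (\<lambda>x. a *\<^sub>R grad f x + b *\<^sub>R grad g x)"
proof
  fix x
  have scale: "GDERIV (\<lambda>x. c * u x) x :> c *\<^sub>R grad u x" if "C1_function u" for c and u :: "'a \<Rightarrow> real"
    using GDERIV_mult[OF GDERIV_const C1_function_GDERIV[OF that]] by auto
  show "grad (\<lambda>x. a * f x + b * g x) x = a *\<^sub>R grad f x + b *\<^sub>R grad g x"
    by (intro grad_eqI GDERIV_add scale assms)
qed

lemma grad_const: "grad (\<lambda>_. c) = (\<lambda>_. 0)"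
  using grad_eqI[OF GDERIV_const] by blast

lemma poly_space_mean_zero_C1: "v \<in> poly_space_mean_zero r K \<Longrightarrow> C1_function v"
  by (auto simp: poly_space_mean_zero_def intro: poly_space_C1)

section \<open>Inclusions and linear structure of the polynomial spaces\<close>

lemma finite_bounded_exponents: "finite {a :: 'd::finite \<Rightarrow> nat. sum a UNIV \<le> r}"
proof (rule finite_subset)
  show "{a :: 'd \<Rightarrow> nat. sum a UNIV \<le> r} \<subseteq> PiE UNIV (\<lambda>_. {..r})"
  proof
    fix a :: "'d \<Rightarrow> nat"
    assume "a \<in> {a. sum a UNIV \<le> r}"
    then have "a i \<le> r" for i
      using member_le_sum[of i UNIV a] by simp
    then show "a \<in> PiE UNIV (\<lambda>_. {..r})"
      by auto
  qed
qed (auto intro: finite_PiE)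

lemma poly_space_mono:
  assumes "r \<le> s"
  shows "poly_space r \<subseteq> poly_space s"
proof
  fix v :: "real ^ 'd \<Rightarrow> real"
  assume "v \<in> poly_space r"
  then obtain c where v: "v = (\<lambda>x. \<Sum>a | sum a UNIV \<le> r. c a * (\<Prod>i\<in>UNIV. (x $ i) ^ a i))"
    by (auto simp: poly_space_def)
  \<comment> \<open>The coefficients are padded with zeros in the degrees between \<open>r\<close>
    and \<open>s\<close>.\<close>
  have "v x = (\<Sum>a | sum a UNIV \<le> s. (if sum a UNIV \<le> r then c a else 0) *
      (\<Prod>i\<in>UNIV. (x $ i) ^ a i))" for x
    unfolding v using assms
    by (intro sum.mono_neutral_cong_left finite_bounded_exponents) auto
  then show "v \<in> poly_space s"
    unfolding poly_space_def mem_Collect_eq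
    by (intro exI[where x = "\<lambda>a. if sum a UNIV \<le> r then c a else 0"] ext)
qed

lemma poly_space_linear_combination:
  assumes "v \<in> poly_space r" "w \<in> poly_space r"
  shows "(\<lambda>x. a * v x + b * w x) \<in> poly_space r"
proof -
  obtain c d where v: "v = (\<lambda>x. \<Sum>a | sum a UNIV \<le> r. c a * (\<Prod>i\<in>UNIV. (x $ i) ^ a i))"
    and w: "w = (\<lambda>x. \<Sum>a | sum a UNIV \<le> r. d a * (\<Prod>i\<in>UNIV. (x $ i) ^ a i))"
    using assms by (auto simp: poly_space_def)
  have "(\<lambda>x. a * v x + b * w x) =
      (\<lambda>x. \<Sum>k | sum k UNIV \<le> r. (a * c k + b * d k) * (\<Prod>i\<in>UNIV. (x $ i) ^ k i))"
    unfolding v w by (simp add: sum_distrib_left sum.distrib algebra_simps)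
  then show ?thesis
    unfolding poly_space_def mem_Collect_eq by (rule exI[where x = "\<lambda>k. a * c k + b * d k"])
qed

section \<open>The inner product on a convex body\<close>

text \<open>What is used of an element: compactness makes continuous functions integrable, convexity
  gives a null boundary and a connected interior, and nonempty interior gives positive
  measure.\<close>

locale convex_body =
  fixes K :: "'a::euclidean_space set"
  assumes convex_body: "convex K" "compact K" "interior K \<noteq> {}"
begin

lemma lebesgue_sets: "K \<in> sets lebesgue"
  using convex_body(2) by (simp add: borel_compact)

lemma negligible_skeleton: "negligible (K - interior K)"
  by (rule negligible_subset[OF negligible_convex_frontier[OF convex_body(1)]])
     (auto simp: frontier_def closure_closed convex_body(2) compact_imp_closed)

lemma continuous_integrable:
  fixes f :: "'a \<Rightarrow> real"
  assumes "continuous_on K f"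
  shows "integrable (lebesgue_on K) f"
proof -
  have "integrable lborel (\<lambda>x. indicator K x *\<^sub>R f x)"
    by (rule borel_integrable_compact[OF convex_body(2) assms])
  then have "integrable lebesgue (\<lambda>x. indicator K x *\<^sub>R f x)"
    by (simp add: integrable_completion borel_measurable_integrable)
  then show ?thesis
    by (simp add: integrable_restrict_space lebesgue_sets)
qed

text \<open>The boundary is a null set. Measurability of \<open>f\<close> is derived:
  \<open>f\<close> differs from the measurable \<open>f'\<close> only on that set, and Lebesgue
  measure is complete.\<close>

lemma integral_cong_interior:
  fixes f f' :: "'a \<Rightarrow> real"
  assumes f': "continuous_on K f'" and eq: "\<And>x. x \<in> interior K \<Longrightarrow> f x = f' x"
  shows "(LINT x|lebesgue_on K. f x) = (LINT x|lebesgue_on K. f' x)"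
proof (rule integral_cong_AE)
  have meas: "f' \<in> borel_measurable (lebesgue_on K)"
    using continuous_integrable[OF f'] by (rule borel_measurable_integrable)
  show "f' \<in> borel_measurable (lebesgue_on K)"
    by (rule meas)
  show "f \<in> borel_measurable (lebesgue_on K)"
    using measurable_on_spike[OF _ negligible_skeleton, of f' K f] meas eq
    by (simp add: measurable_on_iff_borel_measurable lebesgue_sets)
  have "AE x in lebesgue. x \<notin> K - interior K"
    using negligible_skeleton by (intro AE_not_in) (simp add: negligible_iff_null_sets)
  then show "AE x in lebesgue_on K. f x = f' x"
    using eq by (auto simp: AE_restrict_space_iff lebesgue_sets)
qed

lemma l2_inner_cong_interior:
  assumes "continuous_on K f'" "continuous_on K g'"
    and "\<And>x. x \<in> interior K \<Longrightarrow> f x = f' x" "\<And>x. x \<in> interior K \<Longrightarrow> g x = g' x"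
  shows "l2_inner K f g = l2_inner K f' g'"
  unfolding l2_inner_def using assms
  by (intro integral_cong_interior continuous_on_inner) auto

section \<open>Bilinearity, definiteness and the Cauchy-Schwarz inequality\<close>

lemma l2_inner_linear_left:
  assumes "continuous_on K f" "continuous_on K g" "continuous_on K h"
  shows "l2_inner K (\<lambda>x. a *\<^sub>R f x + b *\<^sub>R g x) h = a * l2_inner K f h + b * l2_inner K g h"
proof -
  have "integrable (lebesgue_on K) (\<lambda>x. f x \<bullet> h x)" "integrable (lebesgue_on K) (\<lambda>x. g x \<bullet> h x)"
    using assms by (auto intro!: continuous_integrable continuous_on_inner)
  then show ?thesis
    by (simp add: l2_inner_def inner_add_left)
qed

lemma l2_inner_commute: "l2_inner D f g = l2_inner D g f"
  by (simp add: l2_inner_def inner_commute)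

lemma l2_inner_linear_right:
  assumes "continuous_on K f" "continuous_on K g" "continuous_on K h"
  shows "l2_inner K h (\<lambda>x. a *\<^sub>R f x + b *\<^sub>R g x) = a * l2_inner K h f + b * l2_inner K h g"
  using l2_inner_linear_left[OF assms] by (simp add: l2_inner_commute)

lemma l2_inner_nonneg: "0 \<le> l2_inner D f f"
  by (simp add: l2_inner_def)

lemma l2_norm_nonneg: "0 \<le> l2_norm D f"
  by (simp add: l2_norm_def l2_inner_nonneg)

lemma l2_norm_square: "(l2_norm D f)\<^sup>2 = l2_inner D f f"
  by (simp add: l2_norm_def l2_inner_nonneg)

lemma l2_norm_linear_combination_square:
  assumes "continuous_on K f" "continuous_on K g"
  shows "(l2_norm K (\<lambda>x. a *\<^sub>R f x + b *\<^sub>R g x))\<^sup>2 =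
    a\<^sup>2 * l2_inner K f f + 2 * a * b * l2_inner K f g + b\<^sup>2 * l2_inner K g g"
  unfolding l2_norm_square using assms
  by (simp add: l2_inner_linear_left l2_inner_linear_right continuous_intros
      l2_inner_commute[of K g f] power2_eq_square algebra_simps)

text \<open>A vanishing integral gives \<open>f = 0\<close> only almost everywhere; since the zero
  set is closed, it contains the whole open interior.\<close>

lemma l2_inner_zero_imp_zero:
  fixes f :: "'a \<Rightarrow> 'b::euclidean_space"
  assumes f: "continuous_on UNIV f" and "l2_inner K f f = 0" and x: "x \<in> interior K"
  shows "f x = 0"
proof -
  have "integrable (lebesgue_on K) (\<lambda>x. f x \<bullet> f x)"
    using f by (auto intro!: continuous_integrable continuous_on_inner intro: continuous_on_subset)
  then have "AE x in lebesgue_on K. f x \<bullet> f x = 0"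
    using assms(2) by (subst (asm) l2_inner_def) (subst (asm) integral_nonneg_eq_0_iff_AE; auto)
  then have "AE x in lebesgue. x \<in> K \<longrightarrow> f x = 0"
    by (simp add: AE_restrict_space_iff lebesgue_sets)
  then have ae: "AE x\<in>interior K in lebesgue. x \<in> {x. f x = 0}"
    by (rule AE_mp) (auto intro!: AE_I2 dest: subsetD[OF interior_subset])
  have "closed {x. f x = 0}"
    using f by (intro closed_Collect_eq) auto
  then show ?thesis
    using mem_closed_if_AE_lebesgue_open[OF open_interior _ ae x] by simp
qed

lemma l2_cauchy_schwarz:
  assumes f: "continuous_on K f" and g: "continuous_on K g"
  shows "l2_inner K f g \<le> l2_norm K f * l2_norm K g"
proof -
  define a b c where "a = l2_inner K f f" and "b = l2_inner K f g" and "c = l2_inner K g g"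
  have pos: "0 \<le> t\<^sup>2 * a + 2 * t * s * b + s\<^sup>2 * c" for t s
    using l2_norm_linear_combination_square[OF f g, of t s]
    by (simp add: a_def b_def c_def) (metis zero_le_power2)
  have ac: "0 \<le> a" "0 \<le> c"
    by (simp_all add: a_def c_def l2_inner_nonneg)
  have "b\<^sup>2 \<le> a * c"
  proof (cases "c = 0")
    case True
    show ?thesis
    proof (cases "b = 0")
      case False
      \<comment> \<open>With \<open>c = 0\<close> the form is affine in \<open>s\<close>; this
        \<open>s\<close> gives it the value \<open>-1\<close>, a contradiction.\<close>
      have "0 \<le> a + 2 * (- (a + 1) / (2 * b)) * b"
        using pos[of 1 "- (a + 1) / (2 * b)"] True by simp
      then have "0 \<le> a - (a + 1)"
        using False by (simp add: field_simps)
      then show ?thesis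
        by simp
    qed (use ac in simp)
  next
    case False
    \<comment> \<open>The choice \<open>t = c\<close>, \<open>s = - b\<close> is the usual
      minimizing one, scaled by \<open>c\<close> to avoid a quotient.\<close>
    have "c\<^sup>2 * a + 2 * c * (- b) * b + (- b)\<^sup>2 * c = c * (a * c - b\<^sup>2)"
      by (simp add: power2_eq_square algebra_simps)
    then have "0 \<le> c * (a * c - b\<^sup>2)"
      using pos[of c "- b"] by simp
    then show ?thesis
      using False ac by (simp add: zero_le_mult_iff)
  qed
  then have "\<bar>b\<bar> \<le> sqrt (a * c)"
    by (simp add: real_le_rsqrt)
  then show ?thesis
    by (simp add: l2_norm_def real_sqrt_mult a_def b_def c_def)
qed

lemma l2_inner_one_pos: "0 < l2_inner K (\<lambda>_. 1 :: real) (\<lambda>_. 1)"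
proof -
  have "l2_inner K (\<lambda>_. 1 :: real) (\<lambda>_. 1) \<noteq> 0"
    using l2_inner_zero_imp_zero[of "\<lambda>_. 1 :: real"] convex_body(3) by fastforce
  then show ?thesis
    using l2_inner_nonneg[of K "\<lambda>_. 1 :: real"] by simp
qed

end

section \<open>The discrete dual norm\<close>

text \<open>The dual norm sees its argument only through integrals over \<open>K\<close>, so a field
  may be replaced by its continuous representative.\<close>

lemma dual_norm_cong_interior:
  assumes "convex_body K" "continuous_on K \<tau>'" "\<And>x. x \<in> interior K \<Longrightarrow> \<tau> x = \<tau>' x"
  shows "dual_norm p K \<tau> = dual_norm p K \<tau>'"
proof -
  interpret convex_body K by fact
  have "l2_inner K \<tau> (grad v) = l2_inner K \<tau>' (grad v)" if "v \<in> poly_space_mean_zero (p + 2) K" for v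
    using assms(2,3) poly_space_mean_zero_C1[OF that]
    by (intro l2_inner_cong_interior C1_function_continuous_grad) auto
  then show ?thesis
    unfolding dual_norm_def by (intro SUP_cong refl) auto
qed

text \<open>Cauchy-Schwarz bounds all quotients by the norm of \<tau>, so the real-valued
  \<open>SUP\<close> is a true supremum and dominates each of them.\<close>

lemma dual_norm_upper:
  assumes K: "convex_body K" and \<tau>: "continuous_on K \<tau>" and v: "v \<in> poly_space_mean_zero (p + 2) K"
  shows "l2_inner K \<tau> (grad v) \<le> dual_norm p K \<tau> * l2_norm K (grad v)"
proof -
  interpret convex_body K by (rule K)
  let ?V = "poly_space_mean_zero (p + 2) K"
  have cs: "l2_inner K \<tau> (grad u) \<le> l2_norm K \<tau> * l2_norm K (grad u)" if "u \<in> ?V" for u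
    using \<tau> poly_space_mean_zero_C1[OF that]
    by (intro l2_cauchy_schwarz C1_function_continuous_grad)
  show ?thesis
  proof (cases "l2_norm K (grad v) = 0")
    \<comment> \<open>The quotient is 0 by convention here and says nothing; Cauchy-Schwarz itself
      makes the left side nonpositive.\<close>
    case True
    with cs[OF v] show ?thesis
      by simp
  next
    case False
    then have pos: "0 < l2_norm K (grad v)"
      using l2_norm_nonneg[of K "grad v"] by simp
    have "l2_inner K \<tau> (grad u) / l2_norm K (grad u) \<le> l2_norm K \<tau>" if "u \<in> ?V" for u
      using cs[OF that] l2_norm_nonneg[of K "grad u"] l2_norm_nonneg[of K \<tau>]
      by (cases "l2_norm K (grad u) = 0") (auto simp: divide_le_eq)
    then have "bdd_above ((\<lambda>u. l2_inner K \<tau> (grad u) / l2_norm K (grad u)) ` {u \<in> ?V. u \<noteq> (\<lambda>_. 0)})"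
      by (intro bdd_aboveI2[where M = "l2_norm K \<tau>"]) auto
    moreover have "v \<noteq> (\<lambda>_. 0)"
      using pos by (auto simp: grad_const l2_norm_def l2_inner_def)
    ultimately have "l2_inner K \<tau> (grad v) / l2_norm K (grad v) \<le> dual_norm p K \<tau>"
      unfolding dual_norm_def using v by (intro cSUP_upper) auto
    then show ?thesis
      using pos by (simp add: divide_le_eq)
  qed
qed

text \<open>Testing with combinations of \<open>g\<close> and of the part of \<open>v\<close> orthogonal to \<open>g\<close> makes the Riesz
  representative of the functional unnecessary.\<close>

lemma dual_norm_pythagoras:
  assumes K: "convex_body K" and \<tau>: "continuous_on K \<tau>"
    and g: "g \<in> poly_space_mean_zero (p + 2) K"
    and orth: "l2_inner K \<tau> (grad g) = 0"
    and pos: "0 < l2_norm K (grad g)"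
  shows "(dual_norm p K \<tau>)\<^sup>2 + (l2_norm K (grad g))\<^sup>2 \<le> (dual_norm p K (\<lambda>x. \<tau> x + grad g x))\<^sup>2"
proof -
  interpret convex_body K by (rule K)
  let ?V = "poly_space_mean_zero (p + 2) K"
  define N G where "N = dual_norm p K (\<lambda>x. \<tau> x + grad g x)" and "G = l2_norm K (grad g)"
  note C1 = poly_space_mean_zero_C1[where r = "p + 2" and K = K]
  note cont = C1_function_continuous_grad[OF C1, where S = K]
  have G2: "l2_inner K (grad g) (grad g) = G\<^sup>2"
    by (simp add: G_def l2_norm_square)
  have comb: "(\<lambda>x. a * v x + b * w x) \<in> ?V" if v: "v \<in> ?V" and w: "w \<in> ?V" for a b v w
  proof -
    have "l2_inner K (\<lambda>x. a *\<^sub>R v x + b *\<^sub>R w x) (\<lambda>_. 1) = 0"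
      using v w
      by (subst l2_inner_linear_left)
         (auto simp: poly_space_mean_zero_def intro!: C1_function_continuous C1[OF v] C1[OF w])
    then show ?thesis
      using v w by (auto simp: poly_space_mean_zero_def intro: poly_space_linear_combination)
  qed
  have sum_left: "l2_inner K (\<lambda>x. \<tau> x + grad g x) (grad v) =
      l2_inner K \<tau> (grad v) + l2_inner K (grad g) (grad v)" if "v \<in> ?V" for v
    using l2_inner_linear_left[OF \<tau> cont[OF g] cont[OF that], of 1 1] by simp
  have N_upper: "l2_inner K \<tau> (grad v) + l2_inner K (grad g) (grad v) \<le> N * l2_norm K (grad v)"
    if "v \<in> ?V" for v
    using dual_norm_upper[OF K _ that, of "\<lambda>x. \<tau> x + grad g x"] \<tau> cont[OF g]
    by (simp add: N_def sum_left[OF that] continuous_on_add)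
  have G_pos: "0 < G"
    using pos by (simp add: G_def)
  \<comment> \<open>Testing with \<open>g\<close> alone already yields \<open>G \<le> N\<close>, so
    that the square root below has a nonnegative argument.\<close>
  have "G\<^sup>2 \<le> N * G"
    using N_upper[OF g] by (simp add: orth G2) (simp add: G_def)
  then have "G \<le> N"
    using G_pos by (simp add: power2_eq_square)
  then have GN: "G\<^sup>2 \<le> N\<^sup>2"
    using G_pos by (simp add: power_mono)
  have bound: "l2_inner K \<tau> (grad v) / l2_norm K (grad v) \<le> sqrt (N\<^sup>2 - G\<^sup>2)" if v: "v \<in> ?V" for v
  proof (cases "0 < l2_inner K \<tau> (grad v) \<and> 0 < l2_norm K (grad v)")
    case True
    define r where "r = l2_inner K \<tau> (grad v)"
    \<comment> \<open>\<open>s\<close> is the projection coefficient that removes from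
      \<open>grad v\<close> its component along \<open>grad g\<close>. As \<tau> is orthogonal to
      \<open>grad g\<close>, pairing with \<tau> does not notice the change, while the length can
      only shrink.\<close>
    define s where "s = - l2_inner K (grad v) (grad g) / G\<^sup>2"
    define v' where "v' = (\<lambda>x. 1 * v x + s * g x)"
    define m where "m = (l2_norm K (grad v'))\<^sup>2"
    have v': "v' \<in> ?V"
      unfolding v'_def using v g by (rule comb)
    have grad_v': "grad v' = (\<lambda>x. 1 *\<^sub>R grad v x + s *\<^sub>R grad g x)"
      unfolding v'_def by (rule grad_linear_combination[OF C1[OF v] C1[OF g]])
    have r': "l2_inner K \<tau> (grad v') = r"
      unfolding grad_v' l2_inner_linear_right[OF cont[OF v] cont[OF g] \<tau>] by (simp add: orth r_def)
    have perp: "l2_inner K (grad v') (grad g) = 0"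
      unfolding grad_v' l2_inner_linear_left[OF cont[OF v] cont[OF g] cont[OF g]]
      using G_pos by (simp add: s_def G2)
    have "m = (l2_norm K (grad v))\<^sup>2 - (l2_inner K (grad v) (grad g))\<^sup>2 / G\<^sup>2"
      unfolding m_def grad_v' l2_norm_linear_combination_square[OF cont[OF v] cont[OF g]]
      unfolding G2 s_def l2_norm_square using G_pos by (simp add: power2_eq_square field_simps)
    then have m_le: "m \<le> (l2_norm K (grad v))\<^sup>2"
      by simp
    \<comment> \<open>On the span of \<open>v'\<close> and \<open>g\<close>, the pairing with
      \<open>\<tau> + grad g\<close> takes the values \<open>r\<close> on \<open>v'\<close> and
      \<open>G\<^sup>2\<close> on \<open>g\<close>. Its Riesz representative is
      \<open>(r / m) v' + g\<close> when \<open>m\<close> is nonzero; \<open>z\<close> is this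
      multiplied by \<open>m\<close>, which avoids the division.\<close>
    define z where "z = (\<lambda>x. r * v' x + m * g x)"
    have z: "z \<in> ?V"
      unfolding z_def using v' g by (rule comb)
    have grad_z: "grad z = (\<lambda>x. r *\<^sub>R grad v' x + m *\<^sub>R grad g x)"
      unfolding z_def by (rule grad_linear_combination[OF C1[OF v'] C1[OF g]])
    define R where "R = r\<^sup>2 + m * G\<^sup>2"
    have "l2_inner K \<tau> (grad z) + l2_inner K (grad g) (grad z) = R"
      unfolding grad_z l2_inner_linear_right[OF cont[OF v'] cont[OF g] \<tau>]
        l2_inner_linear_right[OF cont[OF v'] cont[OF g] cont[OF g]]
      by (simp add: orth r' perp l2_inner_commute[of K "grad g" "grad v'"] G2 R_def power2_eq_square)
    moreover have z2: "(l2_norm K (grad z))\<^sup>2 = m * R"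
      unfolding grad_z l2_norm_linear_combination_square[OF cont[OF v'] cont[OF g]]
      unfolding perp G2 R_def m_def l2_norm_square by (simp add: power2_eq_square algebra_simps)
    ultimately have RN: "R \<le> N * l2_norm K (grad z)"
      using N_upper[OF z] by simp
    have "0 \<le> m"
      by (simp add: m_def)
    then have R_pos: "0 < R"
      using True by (auto simp: R_def r_def intro!: add_pos_nonneg)
    \<comment> \<open>The pairing with \<open>z\<close> is \<open>R\<close> and the squared norm of
      \<open>grad z\<close> is \<open>m * R\<close>; squaring the bound allows one factor
      \<open>R > 0\<close> to be cancelled.\<close>
    have "R\<^sup>2 \<le> (N * l2_norm K (grad z))\<^sup>2"
      using RN R_pos by (intro power_mono) auto
    then have "R * R \<le> R * (N\<^sup>2 * m)"
      by (simp add: power_mult_distrib z2) (simp add: power2_eq_square mult_ac)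
    then have "R \<le> N\<^sup>2 * m"
      using R_pos by (rule mult_left_le_imp_le)
    then have "r\<^sup>2 \<le> (N\<^sup>2 - G\<^sup>2) * m"
      by (simp add: R_def algebra_simps)
    also have "\<dots> \<le> (N\<^sup>2 - G\<^sup>2) * (l2_norm K (grad v))\<^sup>2"
      using m_le GN by (intro mult_left_mono) auto
    finally have "(r / l2_norm K (grad v))\<^sup>2 \<le> N\<^sup>2 - G\<^sup>2"
      using True by (simp add: power_divide divide_le_eq)
    then show ?thesis
      unfolding r_def by (rule real_le_rsqrt)
  next
    case False
    \<comment> \<open>Either the numerator is nonpositive or the denominator vanishes, in which case
      the quotient is 0.\<close>
    then have "l2_inner K \<tau> (grad v) / l2_norm K (grad v) \<le> 0"
      using l2_norm_nonneg[of K "grad v"] by (auto simp: divide_le_0_iff)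
    then show ?thesis
      using GN by (meson diff_ge_0_iff_ge order_trans real_sqrt_ge_zero)
  qed
  \<comment> \<open>\<open>g\<close> witnesses that the supremum runs over a nonempty set, as
    \<open>cSUP_least\<close> requires.\<close>
  have "g \<noteq> (\<lambda>_. 0)"
    using pos by (auto simp: grad_const l2_norm_def l2_inner_def)
  then have "dual_norm p K \<tau> \<le> sqrt (N\<^sup>2 - G\<^sup>2)"
    unfolding dual_norm_def using g bound by (intro cSUP_least) auto
  \<comment> \<open>The zero pairing with \<open>g\<close> is at most the dual norm times a positive
    number; nonnegativity then permits squaring.\<close>
  moreover have "0 \<le> dual_norm p K \<tau>"
    using dual_norm_upper[OF K \<tau> g] orth pos by (simp add: zero_le_mult_iff)
  ultimately have "(dual_norm p K \<tau>)\<^sup>2 \<le> N\<^sup>2 - G\<^sup>2"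
    using GN by (metis diff_ge_0_iff_ge power_mono real_sqrt_pow2)
  then show ?thesis
    by (simp add: N_def G_def)
qed

section \<open>Uniqueness of the minimizer on one element\<close>

lemma grad_zero_imp_constant:
  assumes K: "convex_body K" and g: "C1_function g" and "l2_norm K (grad g) = 0"
  obtains c where "\<And>x. x \<in> interior K \<Longrightarrow> g x = c"
proof -
  interpret convex_body K by (rule K)
  have "l2_inner K (grad g) (grad g) = 0"
    using assms(3) by (simp flip: l2_norm_square)
  then have "grad g x = 0" if "x \<in> interior K" for x
    using that C1_function_continuous_grad[OF g] by (rule_tac l2_inner_zero_imp_zero)
  then have "(g has_derivative (\<lambda>_. 0)) (at x within interior K)" if "x \<in> interior K" for x
    using that C1_function_GDERIV[OF g, of x] by (simp add: gderiv_def has_derivative_at_withinI)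
  \<comment> \<open>The interior of a convex set is convex, so a vanishing derivative there forces
    one single constant.\<close>
  then show thesis
    using has_derivative_zero_constant[OF convex_interior[OF convex_body(1)]] that by metis
qed

text \<open>The claim on one element, for polynomial representatives. The degree bound lets
  \<open>w - P\<close> serve both in the orthogonality relation of degree \<open>s\<close> and as a
  test function of degree \<open>p + 2\<close>.\<close>

lemma dual_norm_minimizer_unique:
  assumes K: "convex_body K" and Q: "continuous_on K Q" and "s \<le> p + 2"
    and P: "P \<in> poly_space s" and w: "w \<in> poly_space s"
    and orth: "\<And>v. v \<in> poly_space_mean_zero s K \<Longrightarrow> l2_inner K (\<lambda>x. Q x + grad P x) (grad v) = 0"
    and min: "(dual_norm p K (\<lambda>x. Q x + grad w x))\<^sup>2 \<le> (dual_norm p K (\<lambda>x. Q x + grad P x))\<^sup>2"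
    and mean: "l2_inner K w (\<lambda>_. 1) = l2_inner K P (\<lambda>_. 1)"
    and x: "x \<in> interior K"
  shows "w x = P x"
proof -
  interpret convex_body K by (rule K)
  define g where "g = (\<lambda>x. 1 * w x + (- 1) * P x)"
  note C1 = poly_space_C1[OF P] poly_space_C1[OF w]
  have "l2_inner K (\<lambda>x. 1 *\<^sub>R w x + (- 1) *\<^sub>R P x) (\<lambda>_. 1) = 0"
    using mean by (subst l2_inner_linear_left) (auto intro: C1_function_continuous C1)
  then have g_mean: "l2_inner K g (\<lambda>_. 1) = 0"
    by (simp add: g_def)
  have "g \<in> poly_space s"
    unfolding g_def using w P by (rule poly_space_linear_combination)
  then have gs: "g \<in> poly_space_mean_zero s K" and gp: "g \<in> poly_space_mean_zero (p + 2) K"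
    using g_mean poly_space_mono[OF \<open>s \<le> p + 2\<close>] by (auto simp: poly_space_mean_zero_def)
  have g_C1: "C1_function g"
    using \<open>g \<in> poly_space s\<close> by (rule poly_space_C1)
  have "grad g = (\<lambda>x. grad w x - grad P x)"
    unfolding g_def using grad_linear_combination[OF C1(2,1), of 1 "- 1"] by simp
  then have "(\<lambda>x. (Q x + grad P x) + grad g x) = (\<lambda>x. Q x + grad w x)"
    by simp
  moreover have "continuous_on K (\<lambda>x. Q x + grad P x)"
    using Q C1_function_continuous_grad[OF C1(1)] by (rule continuous_on_add)
  \<comment> \<open>A nonzero gradient of \<open>g\<close> would make the residual at
    \<open>w\<close> strictly larger than at \<open>P\<close>, against minimality.\<close>
  ultimately have "(dual_norm p K (\<lambda>x. Q x + grad P x))\<^sup>2 + (l2_norm K (grad g))\<^sup>2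
      \<le> (dual_norm p K (\<lambda>x. Q x + grad w x))\<^sup>2" if "0 < l2_norm K (grad g)"
    using dual_norm_pythagoras[OF K _ gp orth[OF gs] that] by simp
  with min have "\<not> 0 < l2_norm K (grad g)"
    by (smt (verit) zero_less_power)
  then have "l2_norm K (grad g) = 0"
    using l2_norm_nonneg[of K "grad g"] by simp
  then obtain c where c: "\<And>y. y \<in> interior K \<Longrightarrow> g y = c"
    using grad_zero_imp_constant[OF K g_C1] by blast
  \<comment> \<open>The zero mean of \<open>g\<close> is \<open>c\<close> times the positive measure
    of \<open>K\<close>.\<close>
  have "l2_inner K g (\<lambda>_. 1) = l2_inner K (\<lambda>_. c) (\<lambda>_. 1)"
    using c by (intro l2_inner_cong_interior) auto
  also have "\<dots> = c * l2_inner K (\<lambda>_. 1 :: real) (\<lambda>_. 1)"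
    using l2_inner_linear_left[of "\<lambda>_. 1 :: real" "\<lambda>_. 1" "\<lambda>_. 1" c 0] by simp
  finally have "c = 0"
    using g_mean l2_inner_one_pos by simp
  then show ?thesis
    using c[OF x] by (simp add: g_def)
qed

section \<open>The mesh\<close>

text \<open>Full affine dimension makes the relative interior the interior, and the relative
  interior of a nonempty convex set is nonempty.\<close>

lemma full_simplex_convex_body:
  fixes K :: "'a::euclidean_space set"
  assumes "int DIM('a) simplex K"
  shows "convex_body K"
proof
  show "convex K" "compact K"
    using assms convex_simplex compact_simplex by auto
  have "aff_dim K = int DIM('a)"
    using assms by (rule aff_dim_simplex)
  then have "affine hull K = UNIV"
    by (simp add: aff_dim_eq_full)
  moreover have "K \<noteq> {}"
    using \<open>aff_dim K = int DIM('a)\<close> by auto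
  ultimately show "interior K \<noteq> {}"
    using \<open>convex K\<close> rel_interior_interior rel_interior_eq_empty by metis
qed

text \<open>A triangulation is finite and each element has a null boundary. This is the exceptional
  set of the final almost-everywhere statement.\<close>

lemma negligible_mesh_skeleton:
  fixes \<Omega> :: "(real ^ 'd) set"
  assumes "conforming_simplicial_mesh \<Omega> \<T>"
  shows "negligible (\<Union>K\<in>\<T>. K - interior K)"
proof (rule negligible_Union)
  show "finite ((\<lambda>K. K - interior K) ` \<T>)"
    using assms by (simp add: conforming_simplicial_mesh_def triangulation_def)
  fix S
  assume "S \<in> (\<lambda>K. K - interior K) ` \<T>"
  then obtain K where "K \<in> \<T>" and S: "S = K - interior K"
    by blast
  then have "int DIM(real ^ 'd) simplex K"
    using assms by (simp add: conforming_simplicial_mesh_def)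
  then show "negligible S"
    unfolding S by (intro convex_body.negligible_skeleton full_simplex_convex_body)
qed

section \<open>From the single elements to the whole domain\<close>

theorem proposition3p1:
  fixes \<Omega> :: "(real ^ 'd) set"
    and \<T> :: "real \<Rightarrow> (real ^ 'd) set set"
    and h :: real and p :: nat
    and f u\<^sub>D u\<^sub>h \<nu>\<^sub>h ut\<^sub>h :: "real ^ 'd \<Rightarrow> real"
    and q\<^sub>h :: "real ^ 'd \<Rightarrow> real ^ 'd"
  assumes dim: "CARD('d) = 2 \<or> CARD('d) = 3"
    and domain: "polyhedral_lipschitz_domain \<Omega>"
    and mesh: "\<And>h. h > 0 \<Longrightarrow> conforming_simplicial_mesh \<Omega> (\<T> h)"
    and regular: "shape_regular \<T>"
    and h: "h > 0"
    and p: "p \<ge> 1"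
    and f: "f \<in> square_integrable (lebesgue_on \<Omega>)"
    and u\<^sub>D: "u\<^sub>D \<in> H_half \<Omega>"
    and mfem: "mfem_solution \<Omega> (\<T> h) p f u\<^sub>D u\<^sub>h q\<^sub>h"
    and ut_space: "ut\<^sub>h \<in> broken_poly_space \<Omega> (\<T> h) (p + 1)"
    and ut_grad: "\<And>K v. K \<in> \<T> h \<Longrightarrow> v \<in> poly_space_mean_zero (p + 1) K \<Longrightarrow>
          l2_inner K (grad ut\<^sub>h) (grad v) = - l2_inner K q\<^sub>h (grad v)"
    and ut_mean: "\<And>K. K \<in> \<T> h \<Longrightarrow> l2_inner K ut\<^sub>h (\<lambda>_. 1) = l2_inner K u\<^sub>h (\<lambda>_. 1)"
    and nu_space: "\<nu>\<^sub>h \<in> broken_poly_space \<Omega> (\<T> h) (p + 1)"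
    and nu_min: "\<And>K. K \<in> \<T> h \<Longrightarrow> \<exists>w. (\<forall>x\<in>interior K. \<nu>\<^sub>h x = w x) \<and>
          is_arg_min (\<lambda>w. 1 / 2 * (dual_norm p K (\<lambda>x. q\<^sub>h x + grad w x))\<^sup>2)
            (\<lambda>w. w \<in> poly_space (p + 1)) w"
    and nu_mean: "\<And>K. K \<in> \<T> h \<Longrightarrow> l2_inner K \<nu>\<^sub>h (\<lambda>_. 1) = l2_inner K u\<^sub>h (\<lambda>_. 1)"
  shows "AE x in lebesgue_on \<Omega>. \<nu>\<^sub>h x = ut\<^sub>h x"
proof -
  have \<T>: "conforming_simplicial_mesh \<Omega> (\<T> h)"
    using mesh h by blast
  have eq: "\<nu>\<^sub>h x = ut\<^sub>h x" if K_mem: "K \<in> \<T> h" and x: "x \<in> interior K" for K x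
  proof -
    have K: "convex_body K"
      using \<T> K_mem by (intro full_simplex_convex_body) (simp add: conforming_simplicial_mesh_def)
    interpret convex_body K by (rule K)
    \<comment> \<open>The values of \<open>q\<^sub>h\<close> on the skeleton are arbitrary; its
      polynomial components assemble into a field \<open>Q\<close> continuous on all of
      \<open>K\<close>.\<close>
    have "\<exists>P\<in>poly_space p. \<forall>x\<in>interior K. q\<^sub>h x $ i = P x" for i
      using mfem K_mem by (auto simp: mfem_solution_def H_div_poly_space_def)
    then obtain R where R: "\<And>i. R i \<in> poly_space p" "\<And>i x. x \<in> interior K \<Longrightarrow> q\<^sub>h x $ i = R i x"
      by metis
    define Q where "Q = (\<lambda>x. \<chi> i. R i x)"
    have Q: "continuous_on K Q"
      unfolding Q_def
      by (intro continuous_on_vec_lambda C1_function_continuous poly_space_C1[OF R(1)])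
    have qQ: "q\<^sub>h y = Q y" if "y \<in> interior K" for y
      using R(2)[OF that] by (simp add: Q_def vec_eq_iff)
    obtain P where P: "P \<in> poly_space (p + 1)" and utP: "\<And>y. y \<in> interior K \<Longrightarrow> ut\<^sub>h y = P y"
      using ut_space K_mem by (auto simp: broken_poly_space_def)
    obtain w where nuw: "\<And>y. y \<in> interior K \<Longrightarrow> \<nu>\<^sub>h y = w y"
      and w_min: "is_arg_min (\<lambda>w. 1 / 2 * (dual_norm p K (\<lambda>x. q\<^sub>h x + grad w x))\<^sup>2)
            (\<lambda>w. w \<in> poly_space (p + 1)) w"
      using nu_min[OF K_mem] by blast
    have w: "w \<in> poly_space (p + 1)"
      using w_min by (simp add: is_arg_min_def)
    note C1 = poly_space_C1[OF P] poly_space_C1[OF w]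
    \<comment> \<open>Stated for every \<open>u\<close>, so that the objective changes from
      \<open>q\<^sub>h\<close> to \<open>Q\<close> at the minimizer and at its competitor
      alike.\<close>
    have dual: "dual_norm p K (\<lambda>x. q\<^sub>h x + grad u x) = dual_norm p K (\<lambda>x. Q x + grad u x)"
      if "C1_function u" for u
      using Q C1_function_continuous_grad[OF that] qQ
      by (intro dual_norm_cong_interior[OF K]) (auto intro: continuous_on_add)
    have gradP: "grad ut\<^sub>h y = grad P y" if "y \<in> interior K" for y
      using grad_cong_open[OF open_interior that] utP by blast
    have "w x = P x"
    \<comment> \<open>Here \<open>s\<close> is \<open>p + 1\<close>; the degree bound
      \<open>p + 1 \<le> p + 2\<close> is left to the closing \<open>simp\<close>.\<close>
    proof (rule dual_norm_minimizer_unique[OF K Q _ P w _ _ _ x])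
      show "l2_inner K (\<lambda>x. Q x + grad P x) (grad v) = 0" if v: "v \<in> poly_space_mean_zero (p + 1) K" for v
      proof -
        have v_cont: "continuous_on K (grad v)"
          using v by (intro C1_function_continuous_grad poly_space_mean_zero_C1)
        note P_cont = C1_function_continuous_grad[OF C1(1), where S = K]
        have "l2_inner K (grad P) (grad v) = l2_inner K (grad ut\<^sub>h) (grad v)"
          by (intro l2_inner_cong_interior[OF P_cont v_cont, symmetric] gradP refl)
        moreover have "l2_inner K Q (grad v) = l2_inner K q\<^sub>h (grad v)"
          by (intro l2_inner_cong_interior[OF Q v_cont, symmetric] qQ refl)
        moreover have "l2_inner K (\<lambda>x. 1 *\<^sub>R Q x + 1 *\<^sub>R grad P x) (grad v) =
            1 * l2_inner K Q (grad v) + 1 * l2_inner K (grad P) (grad v)"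
          by (rule l2_inner_linear_left[OF Q P_cont v_cont])
        ultimately show ?thesis
          using ut_grad[OF K_mem v] by simp
      qed
      \<comment> \<open>\<open>P\<close> is an admissible competitor for \<open>w\<close>, and the
        factor 1/2 cancels.\<close>
      show "(dual_norm p K (\<lambda>x. Q x + grad w x))\<^sup>2 \<le> (dual_norm p K (\<lambda>x. Q x + grad P x))\<^sup>2"
        using w_min P by (auto simp: is_arg_min_def not_less dual C1)
      have "l2_inner K w (\<lambda>_. 1) = l2_inner K \<nu>\<^sub>h (\<lambda>_. 1)"
        by (intro l2_inner_cong_interior[symmetric] C1_function_continuous C1 nuw refl continuous_on_const)
      moreover have "l2_inner K P (\<lambda>_. 1) = l2_inner K ut\<^sub>h (\<lambda>_. 1)"
        by (intro l2_inner_cong_interior[symmetric] C1_function_continuous C1 utP refl continuous_on_const)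
      ultimately show "l2_inner K w (\<lambda>_. 1) = l2_inner K P (\<lambda>_. 1)"
        using ut_mean[OF K_mem] nu_mean[OF K_mem] by simp
    qed simp
    then show ?thesis
      using nuw utP x by simp
  qed
  have "AE x in lebesgue. x \<notin> (\<Union>K\<in>\<T> h. K - interior K)"
    using negligible_mesh_skeleton[OF \<T>] by (intro AE_not_in) (simp add: negligible_iff_null_sets)
  then have "AE x in lebesgue. x \<in> \<Omega> \<longrightarrow> \<nu>\<^sub>h x = ut\<^sub>h x"
  proof (rule eventually_mono, intro impI)
    fix x
    assume "x \<notin> (\<Union>K\<in>\<T> h. K - interior K)" and "x \<in> \<Omega>"
    \<comment> \<open>The elements cover the closure of \<Omega>, so a point of \<Omega> off the
      skeleton is interior to some element.\<close>
    moreover from \<open>x \<in> \<Omega>\<close> have "x \<in> \<Union>(\<T> h)"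
      using \<T> closure_subset[of \<Omega>] by (auto simp: conforming_simplicial_mesh_def)
    ultimately show "\<nu>\<^sub>h x = ut\<^sub>h x"
      using eq by blast
  qed
  moreover have "\<Omega> \<in> sets lebesgue"
    using domain by (simp add: polyhedral_lipschitz_domain_def lipschitz_domain_def)
  ultimately show ?thesis
    by (simp add: AE_restrict_space_iff)
qed

end
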